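(* Let $\mathbf{Z}$ be a space invariant with respect to $P^{-1}A$, consisting of $m$ eigenvectors $(z_1,\dots,z_m)$, and let $\mathbf{Z}_u=(z_1+\delta_1,\dots,z_m+\delta_m)$, $\delta_i\in\mathbb{C}^n$, be a slight perturbation of it. Let $N$ be the deflated matrix associated with the perturbed space, written $N=N_T+\delta N$, where $\delta N\in\mathcal{M}_n(\mathbb{C})$ is the perturbation and $N_T$ is the block triangular matrix $$N_T=\begin{pmatrix}Q_R|_{\mathrm{Im}(Q_R)}&B\\0&\left((\mathrm{Id}-Q_R)P^{-1}A(\mathrm{Id}-Q_R)\right)|_{\ker(Q_R)}\end{pmatrix}$$ with $Q_R$ the projection on $\mathbf{Z}$. Let $\lambda$ be the spectral radius of $N_T$, corresponding to the largest eigenvalue in modulus associated with an eigenvector that is not in $\mathbf{Z}$, let $V$ be the matrix of eigenvectors of $N_T$, and let $\rho(N)$ be the spectral radius of $N$. Then $$\rho(N)\le\lambda+\kappa_p(V)\,\|\delta N\|_p .$$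
   Context: $A$ and $P$ are invertible real $n\times n$ matrices; $\mathcal{M}_n(\mathbb{C})$ denotes the complex $n\times n$ matrices. The deflated matrix associated with a projection $Q$ is $Q+P^{-1}A(\mathrm{Id}-Q)$. When the projection is onto an invariant space $\mathbf{Z}$, it is block upper triangular in a basis adapted to $\mathrm{Im}(Q_R)\oplus\ker(Q_R)$; this is $N_T$, with upper right block $B=\left(Q_RP^{-1}A(\mathrm{Id}-Q_R)\right)|_{\ker(Q_R)}$. When the projection is onto the perturbed space $\mathbf{Z}_u$, the exact triangular structure is lost, which gives $N=N_T+\delta N$. The spectrum of $\mathrm{Id}-N_T$ consists of zeros (coming from $\mathbf{Z}$) together with the non-deflated eigenvalues of $\mathrm{Id}-P^{-1}A$. For an invertible complex matrix $X$, $\kappa_p(X)=\|X\|_p\|X^{-1}\|_p$ is the condition number associated with the matrix $p$-norm $\|\cdot\|_p$. *)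

theory Defs
  imports
    "HOL-Library.Extended_Real"
    "Jordan_Normal_Form.Gauss_Jordan_Elimination"
    "Jordan_Normal_Form.Matrix_Kernel"
    "Jordan_Normal_Form.Spectral_Radius"
begin

abbreviation cspan :: "nat \<Rightarrow> complex vec set \<Rightarrow> complex vec set" where
  "cspan n S \<equiv> LinearCombinations.module.span class_ring (module_vec TYPE(complex) n) S"

abbreviation clin_dep :: "nat \<Rightarrow> complex vec set \<Rightarrow> bool" where
  "clin_dep n S \<equiv> LinearCombinations.module.lin_dep class_ring (module_vec TYPE(complex) n) S"

definition is_basis_of :: "nat \<Rightarrow> complex vec list \<Rightarrow> complex vec set \<Rightarrow> bool" where
  "is_basis_of n bs S \<longleftrightarrow>
     set bs \<subseteq> carrier_vec n \<and> distinct bs \<and> \<not> clin_dep n (set bs) \<and> cspan n (set bs) = S"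

definition mat_image :: "complex mat \<Rightarrow> complex vec set" where
  "mat_image M = (\<lambda>x. M *\<^sub>v x) ` carrier_vec (dim_col M)"

text \<open>Not necessarily orthogonal: the kernel of the projection is unconstrained.\<close>
definition is_projection_onto :: "nat \<Rightarrow> complex mat \<Rightarrow> complex vec set \<Rightarrow> bool" where
  "is_projection_onto n Q S \<longleftrightarrow> Q \<in> carrier_mat n n \<and> Q * Q = Q \<and> mat_image Q = S"

text \<open>
  The matrix of the map induced by \<open>F\<close> from the span of \<open>bs\<close> to the span of \<open>cs\<close>.  Column
  \<open>j\<close> holds the coordinates of \<open>F\<close> applied to \<open>bs ! j\<close> with respect to \<open>cs\<close>.  It is
  meaningful when \<open>cs\<close> is linearly independent and \<open>F\<close> maps the first span into the second.
\<close>
definition map_matrix :: "nat \<Rightarrow> complex mat \<Rightarrow> complex vec list \<Rightarrow> complex vec list \<Rightarrow> complex mat" where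
  "map_matrix n F bs cs =
     (THE M. M \<in> carrier_mat (length cs) (length bs) \<and>
             F * mat_of_cols n bs = mat_of_cols n cs * M)"

text \<open>Only meaningful for invertible matrices, where \<open>mat_inverse\<close> does not return \<open>None\<close>.\<close>
definition mat_inv :: "'a :: field mat \<Rightarrow> 'a mat" where
  "mat_inv M = the (mat_inverse M)"

definition preconditioned :: "real mat \<Rightarrow> real mat \<Rightarrow> complex mat" where
  "preconditioned P A = map_mat complex_of_real (mat_inv P * A)"

definition deflated :: "nat \<Rightarrow> complex mat \<Rightarrow> complex mat \<Rightarrow> complex mat" where
  "deflated n K Q = Q + K * (1\<^sub>m n - Q)"

text \<open>
  The lists \<open>ws\<close> and \<open>us\<close> are meant to be bases of the image and of the kernel of \<open>Q\<close>.
\<close>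
definition block_triangular :: "nat \<Rightarrow> complex mat \<Rightarrow> complex mat \<Rightarrow>
    complex vec list \<Rightarrow> complex vec list \<Rightarrow> complex mat" where
  "block_triangular n K Q ws us =
     four_block_mat
       (map_matrix n Q ws ws)
       (map_matrix n (Q * K * (1\<^sub>m n - Q)) us ws)
       (0\<^sub>m (length us) (length ws))
       (map_matrix n ((1\<^sub>m n - Q) * K * (1\<^sub>m n - Q)) us us)"

definition vec_pnorm :: "ereal \<Rightarrow> complex vec \<Rightarrow> real" where
  "vec_pnorm p v =
     (if p = \<infinity> then Max (insert 0 ((\<lambda>i. cmod (v $ i)) ` {..<dim_vec v}))
      else (\<Sum>i<dim_vec v. cmod (v $ i) powr real_of_ereal p) powr (1 / real_of_ereal p))"

definition mat_pnorm :: "ereal \<Rightarrow> complex mat \<Rightarrow> real" where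
  "mat_pnorm p M =
     (SUP x \<in> carrier_vec (dim_col M) - {0\<^sub>v (dim_col M)}. vec_pnorm p (M *\<^sub>v x) / vec_pnorm p x)"

definition cond_number :: "ereal \<Rightarrow> complex mat \<Rightarrow> real" where
  "cond_number p X = mat_pnorm p X * mat_pnorm p (mat_inv X)"

text \<open>
  The matrix \<open>M\<close> acts on coordinates with respect to the basis \<open>bs\<close>, so a coordinate vector
  \<open>v\<close> stands for the vector \<open>mat_of_cols n bs *\<^sub>v v\<close>, and that is the one tested for
  membership in \<open>S\<close>.
\<close>
definition eigenvalue_moduli_outside ::
    "nat \<Rightarrow> complex mat \<Rightarrow> complex vec list \<Rightarrow> complex vec set \<Rightarrow> real set" where
  "eigenvalue_moduli_outside n M bs S =
     {cmod \<mu> | \<mu> v. eigenvector M v \<mu> \<and> mat_of_cols n bs *\<^sub>v v \<notin> S}"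

end

theory Submission
  imports Defs "Jordan_Normal_Form.DL_Rank"
begin

text \<open>
  The bound is the Bauer-Fike theorem.  If the columns of \<open>V\<close> are eigenvectors of \<open>M\<close>, then
  \<open>V\<close> diagonalises \<open>M\<close> to some \<open>D\<close>.  For an eigenvector \<open>x\<close> of \<open>M + E\<close> with eigenvalue
  \<open>\<mu>\<close>, the coordinates \<open>y\<close> with \<open>x = V y\<close> satisfy \<open>(\<mu> I - D) y = V\<^sup>-\<^sup>1 E V y\<close>.  The left
  side has p-norm at least the distance from \<open>\<mu>\<close> to the spectrum of \<open>M\<close> times that of \<open>y\<close>,
  because \<open>D\<close> is diagonal; the right side is at most \<open>\<kappa>\<^sub>p(V) \<parallel>E\<parallel>\<^sub>p\<close> times that of \<open>y\<close>.
  So \<open>\<mu>\<close> lies within \<open>\<kappa>\<^sub>p(V) \<parallel>E\<parallel>\<^sub>p\<close> of an eigenvalue of \<open>M\<close>; taking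
  \<open>\<mu>\<close> of maximal modulus gives the inequality between spectral radii.

  To apply this to \<open>N = NT + \<delta>N\<close>, both matrices must be genuine \<open>n \<times> n\<close> matrices.  They are
  given by definite descriptions, so it has to be shown that the coordinates described there
  exist and are unique.  This follows from \<open>C\<^sup>n = Im Q \<oplus> ker Q\<close> for a projection \<open>Q\<close>, which
  makes the concatenation of a basis of the image with one of the kernel a basis of the whole
  space.

  In that basis the block triangular matrix represents the deflated operator
  \<open>Q + K (1 - Q)\<close>, which is the identity on the image of \<open>Q\<close>.  Hence every eigenvector lying
  in the deflated space has eigenvalue 1, and as soon as the largest modulus \<open>\<nu>\<close> of the
  eigenvalues with eigenvectors outside that space is at least 1, it is the spectral radius.
\<close>

section \<open>Bases, coordinates and invertible matrices\<close>

lemma mult_mat_zero_vec: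
  fixes M :: "'a :: semiring_0 mat"
  shows "M \<in> carrier_mat m n \<Longrightarrow> M *\<^sub>v 0\<^sub>v n = 0\<^sub>v m"
  by (intro eq_vecI) auto

lemma eq_vec_if_minus_eq_zero:
  fixes v w :: "'a :: group_add vec"
  assumes v: "v \<in> carrier_vec n" and w: "w \<in> carrier_vec n" and eq: "v - w = 0\<^sub>v n"
  shows "v = w"
proof (rule eq_vecI)
  fix i assume "i < dim_vec w"
  then have i: "i < n" using w by simp
  have "(v - w) $ i = 0" using eq i by simp
  then show "v $ i = w $ i" using i w by simp
qed (use v w in simp)

lemma mat_of_cols_append_mult_vec:
  assumes "set ws \<subseteq> carrier_vec n" "set us \<subseteq> carrier_vec n"
    and a: "a \<in> carrier_vec (length ws)" and b: "b \<in> carrier_vec (length us)"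
  shows "mat_of_cols n (ws @ us) *\<^sub>v (a @\<^sub>v b) = mat_of_cols n ws *\<^sub>v a + mat_of_cols n us *\<^sub>v b"
proof (rule eq_vecI)
  fix i assume "i < dim_vec (mat_of_cols n ws *\<^sub>v a + mat_of_cols n us *\<^sub>v b)"
  then have i: "i < n" by simp
  have row: "row (mat_of_cols n (ws @ us)) i = row (mat_of_cols n ws) i @\<^sub>v row (mat_of_cols n us) i"
    using i by (intro eq_vecI) (auto simp: mat_of_cols_index nth_append)
  show "(mat_of_cols n (ws @ us) *\<^sub>v (a @\<^sub>v b)) $ i
      = (mat_of_cols n ws *\<^sub>v a + mat_of_cols n us *\<^sub>v b) $ i"
  proof -
    have "row (mat_of_cols n ws) i \<in> carrier_vec (length ws)"
        "row (mat_of_cols n us) i \<in> carrier_vec (length us)"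
      using i by (auto intro!: carrier_vecI)
    from scalar_prod_append[OF this a b] show ?thesis using i by (simp add: row)
  qed
qed simp

text \<open>
  In terms of the matrix \<open>W\<close> with columns \<open>bs\<close>, a basis is an injective \<open>W\<close> with the right
  image.  This form replaces linear combinations by matrix arithmetic.
\<close>

lemma is_basis_of_iff:
  assumes bs: "set bs \<subseteq> carrier_vec n"
  shows "is_basis_of n bs S \<longleftrightarrow>
    (\<forall>v\<in>carrier_vec (length bs). mat_of_cols n bs *\<^sub>v v = 0\<^sub>v n \<longrightarrow> v = 0\<^sub>v (length bs))
    \<and> mat_image (mat_of_cols n bs) = S"
proof -
  interpret vec_space "TYPE(complex)" n .
  let ?W = "mat_of_cols n bs"
  have W: "?W \<in> carrier_mat n (length bs)" by simp
  have cols: "cols ?W = bs" using bs by simp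
  have span: "cspan n (set bs) = mat_image ?W"
    using col_space_eq[OF W] W mult_mat_vec_carrier[OF W]
    unfolding col_space_def cols mat_image_def by (auto simp: image_iff)
  have indep: "distinct bs \<and> \<not> clin_dep n (set bs) \<longleftrightarrow>
      (\<forall>v\<in>carrier_vec (length bs). ?W *\<^sub>v v = 0\<^sub>v n \<longrightarrow> v = 0\<^sub>v (length bs))" (is "?L \<longleftrightarrow> ?R")
  proof
    assume ?L
    then show ?R using lin_depI[OF W] cols by auto
  next
    assume R: ?R
    have "distinct bs"
      unfolding distinct_conv_nth
    proof (intro allI impI notI)
      fix i j assume ij: "i < length bs" "j < length bs" "i \<noteq> j" and eq: "bs ! i = bs ! j"
      \<comment> \<open>A repeated column would put a difference of two unit vectors into the kernel.\<close>
      let ?v = "unit_vec (length bs) i - unit_vec (length bs) j :: complex vec"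
      have "?W *\<^sub>v ?v = ?W *\<^sub>v unit_vec (length bs) i - ?W *\<^sub>v unit_vec (length bs) j"
        by (rule mult_minus_distrib_mat_vec[OF W]) auto
      also have "\<dots> = col ?W i - col ?W j"
        using ij by (intro eq_vecI) auto
      also have "\<dots> = 0\<^sub>v n"
      proof -
        have c: "bs ! j \<in> carrier_vec n" using bs ij(2) by auto
        then have "col ?W i = bs ! j" "col ?W j = bs ! j" using ij eq by simp_all
        then show ?thesis using c by simp
      qed
      finally have "?v = 0\<^sub>v (length bs)" using R by simp
      then have "?v $ i = 0" using ij by simp
      then show False using ij by simp
    qed
    moreover from this have "\<not> clin_dep n (set bs)"
      using lin_depE[OF W] R cols by metis
    ultimately show ?L by blast
  qed
  show ?thesis unfolding is_basis_of_def using bs span indep by auto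
qed

lemma length_basis_of_carrier_vec:
  assumes "is_basis_of n bs (carrier_vec n)"
  shows "length bs = n"
proof -
  interpret vec_space "TYPE(complex)" n .
  from assms have bs: "set bs \<subseteq> carrier_vec n" "distinct bs" "lin_indpt (set bs)"
      "span (set bs) = carrier_vec n"
    unfolding is_basis_of_def by auto
  have "card (set bs) \<le> dim" using li_le_dim(2)[OF fin_dim] bs by auto
  moreover have "dim \<le> card (set bs)" using gen_ge_dim[of "set bs"] bs by auto
  ultimately show ?thesis using distinct_card[OF bs(2)] dim_is_n by simp
qed

text \<open>
  The description defining \<^const>\<open>map_matrix\<close> is proper once the target list is a basis and the
  map sends the source vectors into its span: column \<open>j\<close> exists because the image of the
  \<open>j\<close>-th source vector is a combination of \<open>cs\<close>, and is unique because \<open>cs\<close> is independent.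
\<close>

lemma map_matrix:
  assumes cs: "is_basis_of n cs S" and F: "F \<in> carrier_mat n n" and bs: "set bs \<subseteq> carrier_vec n"
    and FS: "\<And>b. b \<in> set bs \<Longrightarrow> F *\<^sub>v b \<in> S"
  shows "map_matrix n F bs cs \<in> carrier_mat (length cs) (length bs)"
    and "F * mat_of_cols n bs = mat_of_cols n cs * map_matrix n F bs cs"
proof -
  let ?C = "mat_of_cols n cs" and ?B = "mat_of_cols n bs"
  let ?P = "\<lambda>M. M \<in> carrier_mat (length cs) (length bs) \<and> F * ?B = ?C * M"
  have csc: "set cs \<subseteq> carrier_vec n" using cs unfolding is_basis_of_def by auto
  have C: "?C \<in> carrier_mat n (length cs)" and B: "?B \<in> carrier_mat n (length bs)" by auto
  have inj: "v = 0\<^sub>v (length cs)" if "v \<in> carrier_vec (length cs)" "?C *\<^sub>v v = 0\<^sub>v n" for v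
    using cs that unfolding is_basis_of_iff[OF csc] by auto
  have img: "mat_image ?C = S" using cs unfolding is_basis_of_iff[OF csc] by auto
  have "\<forall>j\<in>{..<length bs}. \<exists>x. x \<in> carrier_vec (length cs) \<and> ?C *\<^sub>v x = F *\<^sub>v (bs ! j)"
  proof
    fix j assume "j \<in> {..<length bs}"
    then have "F *\<^sub>v (bs ! j) \<in> mat_image ?C" using FS[of "bs ! j"] img by simp
    then show "\<exists>x. x \<in> carrier_vec (length cs) \<and> ?C *\<^sub>v x = F *\<^sub>v (bs ! j)"
      unfolding mat_image_def by auto
  qed
  then obtain x where x: "\<And>j. j < length bs \<Longrightarrow> x j \<in> carrier_vec (length cs)"
      "\<And>j. j < length bs \<Longrightarrow> ?C *\<^sub>v x j = F *\<^sub>v (bs ! j)"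
    by (metis lessThan_iff)
  let ?M = "mat_of_cols (length cs) (map x [0..<length bs])"
  have ex: "?P ?M"
  proof (intro conjI mat_col_eqI)
    show "?M \<in> carrier_mat (length cs) (length bs)"
      by (rule carrier_matI) auto
    fix j assume "j < dim_col (?C * ?M)"
    then have j: "j < length bs" by simp
    have "col (F * ?B) j = F *\<^sub>v (bs ! j)"
    proof -
      have "bs ! j \<in> carrier_vec n" using bs j by auto
      then show ?thesis using col_mult2[OF F B j] j by simp
    qed
    also have "\<dots> = ?C *\<^sub>v col ?M j" using j x by (subst col_mat_of_cols) auto
    also have "\<dots> = col (?C * ?M) j"
      using j by (subst col_mult2[OF C, of _ "length bs"]) auto
    finally show "col (F * ?B) j = col (?C * ?M) j" .
  qed (use F in auto)
  moreover have uniq: "M = M'" if M: "?P M" and M': "?P M'" for M M'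
  proof (rule mat_col_eqI)
    fix j assume "j < dim_col M'"
    then have j: "j < length bs" using M' by auto
    have c: "col M j \<in> carrier_vec (length cs)" "col M' j \<in> carrier_vec (length cs)"
      using M M' j by auto
    have "?C *\<^sub>v col M j = col (?C * M) j" "?C *\<^sub>v col M' j = col (?C * M') j"
      using M M' j C by (metis col_mult2)+
    then have "?C *\<^sub>v (col M j - col M' j) = 0\<^sub>v n"
      using M M' mult_minus_distrib_mat_vec[OF C c] mult_mat_vec_carrier[OF C c(2)] by simp
    from inj[OF _ this] c have d: "col M j - col M' j = 0\<^sub>v (length cs)" by auto
    show "col M j = col M' j" using eq_vec_if_minus_eq_zero[OF c d] .
  qed (use M M' in auto)
  ultimately have "?P (map_matrix n F bs cs)"
    unfolding map_matrix_def by (intro theI[of ?P ?M]) auto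
  then show "map_matrix n F bs cs \<in> carrier_mat (length cs) (length bs)"
    and "F * mat_of_cols n bs = mat_of_cols n cs * map_matrix n F bs cs" by auto
qed

lemma mat_inv:
  fixes M :: "'a :: field mat"
  assumes M: "M \<in> carrier_mat n n" and inv: "invertible_mat M"
  shows "mat_inv M \<in> carrier_mat n n" "M * mat_inv M = 1\<^sub>m n" "mat_inv M * M = 1\<^sub>m n"
proof -
  from inv obtain B where B: "inverts_mat M B" "inverts_mat B M" unfolding invertible_mat_def by auto
  have MB: "M * B = 1\<^sub>m n" using B(1) M unfolding inverts_mat_def by auto
  have BM: "B * M = 1\<^sub>m (dim_row B)" using B(2) unfolding inverts_mat_def by auto
  have "dim_col B = n" using arg_cong[OF MB, of dim_col] by simp
  moreover have "dim_row B = n" using arg_cong[OF BM, of dim_col] M by simp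
  ultimately have "M \<in> Units (ring_mat TYPE('a) n ())"
    using M MB BM unfolding Units_def by (auto simp: ring_mat_simps)
  then obtain C where C: "mat_inverse M = Some C" using mat_inverse(1)[OF M] by fastforce
  from mat_inverse(2)[OF M C] C
  show "mat_inv M \<in> carrier_mat n n" "M * mat_inv M = 1\<^sub>m n" "mat_inv M * M = 1\<^sub>m n"
    unfolding mat_inv_def by auto
qed

section \<open>The p-norms of vectors and matrices\<close>

lemma real_of_ereal_ge_1: "1 \<le> p \<Longrightarrow> p \<noteq> \<infinity> \<Longrightarrow> 1 \<le> real_of_ereal p"
  by (cases p) auto

lemma cmod_nth_le_vec_pnorm:
  assumes p: "1 \<le> p" and i: "i < dim_vec v"
  shows "cmod (v $ i) \<le> vec_pnorm p v"
proof (cases "p = \<infinity>")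
  case True
  then show ?thesis using i by (auto simp: vec_pnorm_def intro!: Max_ge)
next
  case False
  define r where "r = real_of_ereal p"
  have r: "r > 0" using real_of_ereal_ge_1[OF p False] by (simp add: r_def)
  have "cmod (v $ i) = (cmod (v $ i) powr r) powr (1 / r)" using r by (simp add: powr_powr)
  also have "\<dots> \<le> (\<Sum>i<dim_vec v. cmod (v $ i) powr r) powr (1 / r)"
    using r i by (intro powr_mono2 member_le_sum) auto
  finally show ?thesis using False by (simp add: vec_pnorm_def r_def)
qed

lemma vec_pnorm_nonneg: "0 \<le> vec_pnorm p v"
  unfolding vec_pnorm_def by (auto intro!: Max_ge)

lemma vec_pnorm_pos:
  assumes "1 \<le> p" "v \<in> carrier_vec n" "v \<noteq> 0\<^sub>v n"
  shows "0 < vec_pnorm p v"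
proof -
  obtain i where i: "i < n" "v $ i \<noteq> 0" using assms by (auto simp: vec_eq_iff)
  then have "0 < cmod (v $ i)" by simp
  also have "\<dots> \<le> vec_pnorm p v" using assms i by (intro cmod_nth_le_vec_pnorm) auto
  finally show ?thesis .
qed

text \<open>
  Monotonicity of the p-norm and its positive homogeneity are both contained in this one
  entrywise comparison, from which the norm estimates below are obtained.
\<close>

lemma mult_vec_pnorm_le:
  assumes p: "1 \<le> p" and dim: "dim_vec v = dim_vec w" and c: "0 \<le> c"
    and le: "\<And>i. i < dim_vec w \<Longrightarrow> c * cmod (v $ i) \<le> cmod (w $ i)"
  shows "c * vec_pnorm p v \<le> vec_pnorm p w"
proof (cases "p = \<infinity>")
  case True
  have "vec_pnorm p v \<in> insert 0 ((\<lambda>i. cmod (v $ i)) ` {..<dim_vec v})"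
    unfolding vec_pnorm_def if_P[OF True] by (rule Max_in) auto
  then consider "vec_pnorm p v = 0" | i where "i < dim_vec w" "vec_pnorm p v = cmod (v $ i)"
    using dim by auto
  then show ?thesis
  proof cases
    case 2
    then show ?thesis using le[OF 2(1)] cmod_nth_le_vec_pnorm[OF p 2(1)] by simp
  qed (simp add: vec_pnorm_nonneg)
next
  case False
  define r where "r = real_of_ereal p"
  have r: "r > 0" using real_of_ereal_ge_1[OF p False] by (simp add: r_def)
  have "c * (\<Sum>i<dim_vec v. cmod (v $ i) powr r) powr (1 / r)
      = (c powr r) powr (1 / r) * (\<Sum>i<dim_vec v. cmod (v $ i) powr r) powr (1 / r)"
    using r c by (simp add: powr_powr)
  also have "\<dots> = (\<Sum>i<dim_vec v. (c * cmod (v $ i)) powr r) powr (1 / r)"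
    using c by (simp add: powr_mult sum_nonneg flip: sum_distrib_left)
  also have "\<dots> \<le> (\<Sum>i<dim_vec w. cmod (w $ i) powr r) powr (1 / r)"
    unfolding dim using r c le by (intro powr_mono2 sum_mono sum_nonneg) auto
  finally show ?thesis using False by (simp add: vec_pnorm_def r_def)
qed

text \<open>
  The matrix norm is a supremum of reals, so it carries information only if the quotients are
  bounded.  With \<open>s\<close> the sum of the moduli of all entries of \<open>M\<close>, every entry of \<open>M x\<close> is at
  most \<open>s\<close> times the norm of \<open>x\<close>, since no entry of a vector exceeds its norm.  Comparing with
  the constant vector \<open>s\<close> bounds all quotients by the norm of that vector.
\<close>

lemma bdd_above_pnorm_quotients:
  assumes p: "1 \<le> p"
  shows "bdd_above ((\<lambda>x. vec_pnorm p (M *\<^sub>v x) / vec_pnorm p x)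
           ` (carrier_vec (dim_col M) - {0\<^sub>v (dim_col M)}))"
proof -
  define s where "s = (\<Sum>i<dim_row M. \<Sum>j<dim_col M. cmod (M $$ (i, j)))"
  let ?w = "vec (dim_row M) (\<lambda>_. complex_of_real s)"
  have s0: "0 \<le> s" unfolding s_def by (intro sum_nonneg) auto
  have "vec_pnorm p (M *\<^sub>v x) / vec_pnorm p x \<le> vec_pnorm p ?w"
    if x: "x \<in> carrier_vec (dim_col M)" "x \<noteq> 0\<^sub>v (dim_col M)" for x
  proof -
    have pos: "0 < vec_pnorm p x" using vec_pnorm_pos[OF p x] .
    have "1 / vec_pnorm p x * vec_pnorm p (M *\<^sub>v x) \<le> vec_pnorm p ?w"
    proof (rule mult_vec_pnorm_le[OF p])
      fix i assume "i < dim_vec ?w"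
      then have i: "i < dim_row M" by simp
      have "cmod ((M *\<^sub>v x) $ i) \<le> (\<Sum>j<dim_col M. cmod (M $$ (i, j)) * vec_pnorm p x)"
        using i x by (auto simp: scalar_prod_def norm_mult atLeast0LessThan
            intro!: sum_norm_le mult_left_mono cmod_nth_le_vec_pnorm[OF p])
      also have "\<dots> \<le> s * vec_pnorm p x"
        unfolding sum_distrib_right[symmetric] s_def using i
        by (intro mult_right_mono vec_pnorm_nonneg
            member_le_sum[where f = "\<lambda>i. \<Sum>j<dim_col M. cmod (M $$ (i, j))"] sum_nonneg) auto
      finally show "1 / vec_pnorm p x * cmod ((M *\<^sub>v x) $ i) \<le> cmod (?w $ i)"
        using pos i s0 by (simp add: field_simps)
    qed (use pos in auto)
    then show ?thesis by simp
  qed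
  then show ?thesis by (intro bdd_aboveI2[where M = "vec_pnorm p ?w"]) auto
qed

lemma vec_pnorm_mult_mat_vec_le:
  assumes p: "1 \<le> p" and M: "M \<in> carrier_mat m n" and x: "x \<in> carrier_vec n"
  shows "vec_pnorm p (M *\<^sub>v x) \<le> mat_pnorm p M * vec_pnorm p x"
proof (cases "x = 0\<^sub>v n")
  case True
  \<comment> \<open>In dimension 0 the maximum in the case \<open>p = \<infinity>\<close> ranges over the inserted 0 alone.\<close>
  have "vec_pnorm p (0\<^sub>v k) = 0" for k
    by (cases "k = 0") (auto simp: vec_pnorm_def image_constant_conv)
  then show ?thesis using True mult_mat_zero_vec[OF M] by simp
next
  case False
  have "vec_pnorm p (M *\<^sub>v x) / vec_pnorm p x \<le> mat_pnorm p M"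
    unfolding mat_pnorm_def using M x False
    by (intro cSUP_upper bdd_above_pnorm_quotients[OF p]) auto
  then show ?thesis using vec_pnorm_pos[OF p x False] by (simp add: field_simps)
qed

lemma mat_pnorm_nonneg:
  assumes p: "1 \<le> p" and M: "M \<in> carrier_mat m n" and n: "0 < n"
  shows "0 \<le> mat_pnorm p M"
proof -
  let ?e = "unit_vec n 0 :: complex vec"
  have e: "?e \<in> carrier_vec n" "?e \<noteq> 0\<^sub>v n" using n by auto
  have "0 \<le> vec_pnorm p (M *\<^sub>v ?e)" by (rule vec_pnorm_nonneg)
  also have "\<dots> \<le> mat_pnorm p M * vec_pnorm p ?e" using vec_pnorm_mult_mat_vec_le[OF p M e(1)] .
  finally show ?thesis using vec_pnorm_pos[OF p e] by (simp add: zero_le_mult_iff)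
qed

section \<open>The Bauer-Fike theorem\<close>

text \<open>
  Passing to coordinates \<open>y = V\<^sup>-\<^sup>1 x\<close> turns the eigenvalue equation of \<open>M + E\<close> into
  \<open>(\<mu> - d\<^sub>i) y\<^sub>i = (V\<^sup>-\<^sup>1 E V y)\<^sub>i\<close>, so the eigenvalue \<open>d\<^sub>k\<close> nearest to \<open>\<mu>\<close> controls
  all entries at once.  No inverse of \<open>\<mu> I - M\<close> is formed, and an eigenvalue \<open>\<mu>\<close> common to
  \<open>M\<close> and \<open>M + E\<close> is covered without a case distinction.
\<close>

theorem Bauer_Fike:
  fixes M E V :: "complex mat"
  assumes n: "0 < n" and p: "1 \<le> p"
    and M: "M \<in> carrier_mat n n" and E: "E \<in> carrier_mat n n"
    and V: "V \<in> carrier_mat n n" "invertible_mat V"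
    and eig: "\<And>j. j < n \<Longrightarrow> \<exists>\<mu>. eigenvector M (col V j) \<mu>"
    and \<mu>: "eigenvalue (M + E) \<mu>"
  shows "\<exists>\<alpha>. eigenvalue M \<alpha> \<and> cmod (\<mu> - \<alpha>) \<le> cond_number p V * mat_pnorm p E"
proof -
  define U where "U = mat_inv V"
  have U: "U \<in> carrier_mat n n" "V * U = 1\<^sub>m n" "U * V = 1\<^sub>m n"
    unfolding U_def using mat_inv[OF V] .
  from eig obtain d where d: "\<And>j. j < n \<Longrightarrow> eigenvector M (col V j) (d j)" by metis
  obtain k where k: "k < n" and k_min: "\<And>j. j < n \<Longrightarrow> cmod (\<mu> - d k) \<le> cmod (\<mu> - d j)"
    using ex_min_if_finite[of "(\<lambda>j. cmod (\<mu> - d j)) ` {..<n}"] n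
    by (auto simp: not_less)
  define D where "D = mat_diag n d"
  have D: "D \<in> carrier_mat n n" unfolding D_def by simp
  have MV: "M * V = V * D"
  proof (rule mat_col_eqI)
    fix j assume "j < dim_col (V * D)"
    then have j: "j < n" using D by simp
    have "col (M * V) j = d j \<cdot>\<^sub>v col V j"
      using d[OF j] col_mult2[OF M V(1) j] unfolding eigenvector_def by simp
    also have "\<dots> = col (V * D) j"
      using j V unfolding D_def by (intro eq_vecI) (auto simp: mat_diag_mult_right)
    finally show "col (M * V) j = col (V * D) j" .
  qed (use M V D in auto)
  from \<mu> obtain x where x: "x \<in> carrier_vec n" "x \<noteq> 0\<^sub>v n" "(M + E) *\<^sub>v x = \<mu> \<cdot>\<^sub>v x"
    unfolding eigenvalue_def eigenvector_def using M E by auto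
  define y where "y = U *\<^sub>v x"
  have y: "y \<in> carrier_vec n" unfolding y_def using U x by auto
  have Vy: "V *\<^sub>v y = x" unfolding y_def using U V x by (simp flip: assoc_mult_mat_vec)
  have y0: "y \<noteq> 0\<^sub>v n" using Vy x V by auto
  \<comment> \<open>The perturbation term in eigenvector coordinates.\<close>
  define z where "z = U *\<^sub>v (E *\<^sub>v (V *\<^sub>v y))"
  have z: "z \<in> carrier_vec n" unfolding z_def using U E V y by auto
  have "U *\<^sub>v (M *\<^sub>v x) = U *\<^sub>v (V *\<^sub>v (D *\<^sub>v y))"
    using Vy MV M V D y assoc_mult_mat_vec[OF M V(1) y] assoc_mult_mat_vec[OF V(1) D y] by simp
  also have "\<dots> = D *\<^sub>v y"
    using U V assoc_mult_mat_vec[OF U(1) V(1), of "D *\<^sub>v y"] D y by simp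
  finally have UM: "U *\<^sub>v (M *\<^sub>v x) = D *\<^sub>v y" .
  have "\<mu> \<cdot>\<^sub>v y = U *\<^sub>v ((M + E) *\<^sub>v x)"
    unfolding y_def x(3) using mult_mat_vec[OF U(1) x(1)] by simp
  also have "\<dots> = U *\<^sub>v (M *\<^sub>v x + E *\<^sub>v x)" using add_mult_distrib_mat_vec[OF M E x(1)] by simp
  also have "\<dots> = U *\<^sub>v (M *\<^sub>v x) + z"
    unfolding z_def Vy using M E x by (intro mult_add_distrib_mat_vec[OF U(1)]) auto
  finally have main: "\<mu> \<cdot>\<^sub>v y = D *\<^sub>v y + z" unfolding UM .
  have z_nth: "z $ i = (\<mu> - d i) * y $ i" if i: "i < n" for i
  proof -
    have "(D *\<^sub>v y) $ i = d i * y $ i"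
    proof -
      have "row D i \<bullet> y = (\<Sum>j\<in>{0..<n}. if j = i then d i * y $ i else 0)"
        using i y unfolding D_def scalar_prod_def by (intro sum.cong) (auto simp: mat_diag_def)
      then show ?thesis using i D by simp
    qed
    moreover have "\<mu> * y $ i = (D *\<^sub>v y) $ i + z $ i"
      using arg_cong[OF main, of "\<lambda>v. v $ i"] i y z D by simp
    ultimately show ?thesis by (simp add: algebra_simps)
  qed
  have "cmod (\<mu> - d k) * vec_pnorm p y \<le> vec_pnorm p z"
    using y z k_min by (intro mult_vec_pnorm_le[OF p])
      (auto simp: z_nth norm_mult intro!: mult_right_mono)
  also have "\<dots> \<le> mat_pnorm p U * (mat_pnorm p E * (mat_pnorm p V * vec_pnorm p y))"
    unfolding z_def using U(1) E V(1) y
    by (meson order_trans mult_left_mono mat_pnorm_nonneg[OF p _ n]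
        vec_pnorm_mult_mat_vec_le[OF p] mult_mat_vec_carrier)
  also have "\<dots> = cond_number p V * mat_pnorm p E * vec_pnorm p y"
    by (simp add: cond_number_def U_def)
  finally have "cmod (\<mu> - d k) \<le> cond_number p V * mat_pnorm p E"
    using vec_pnorm_pos[OF p y y0] by simp
  then show ?thesis using d[OF k] unfolding eigenvalue_def by blast
qed

corollary spectral_radius_perturbation:
  fixes M E V :: "complex mat"
  assumes n: "0 < n" and p: "1 \<le> p"
    and M: "M \<in> carrier_mat n n" and E: "E \<in> carrier_mat n n"
    and V: "V \<in> carrier_mat n n" "invertible_mat V"
    and eig: "\<And>j. j < n \<Longrightarrow> \<exists>\<mu>. eigenvector M (col V j) \<mu>"
  shows "spectral_radius (M + E) \<le> spectral_radius M + cond_number p V * mat_pnorm p E"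
proof -
  have ME: "M + E \<in> carrier_mat n n" using M E by simp
  obtain \<mu> where \<mu>: "eigenvalue (M + E) \<mu>" "spectral_radius (M + E) = cmod \<mu>"
    using spectral_radius_mem_max(1)[OF ME n] by (auto simp: spectrum_def)
  obtain \<alpha> where \<alpha>: "eigenvalue M \<alpha>" "cmod (\<mu> - \<alpha>) \<le> cond_number p V * mat_pnorm p E"
    using Bauer_Fike[OF n p M E V eig \<mu>(1)] by auto
  have "cmod \<alpha> \<le> spectral_radius M"
    using spectral_radius_mem_max(2)[OF M n] \<alpha>(1) by (auto simp: spectrum_def)
  then show ?thesis using \<mu>(2) \<alpha>(2) norm_triangle_sub[of \<mu> \<alpha>] by linarith
qed

section \<open>The deflated matrix in a basis adapted to the projection\<close>

lemma projection_mult_image: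
  assumes "is_projection_onto n Q S" "v \<in> mat_image Q"
  shows "Q *\<^sub>v v = v"
proof -
  from assms have Q: "Q \<in> carrier_mat n n" "Q * Q = Q" unfolding is_projection_onto_def by auto
  with assms(2) obtain x where "x \<in> carrier_vec n" "v = Q *\<^sub>v x" unfolding mat_image_def by auto
  then show ?thesis using Q assoc_mult_mat_vec[OF Q(1) Q(1)] by simp
qed

text \<open>
  Every \<open>x\<close> splits as \<open>Q x + (x - Q x)\<close> into a part in the image and a part in the kernel, so
  the joined list spans.  If \<open>a + b = 0\<close> with \<open>a\<close> in the image and \<open>b\<close> in the kernel, then
  applying \<open>Q\<close> gives \<open>a = 0\<close>, so it is independent.
\<close>

lemma is_basis_of_projection_append:
  assumes Q: "is_projection_onto n Q S"
    and ws: "is_basis_of n ws (mat_image Q)" and us: "is_basis_of n us (mat_kernel Q)"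
  shows "is_basis_of n (ws @ us) (carrier_vec n)"
proof -
  let ?k = "length ws" and ?l = "length us"
  let ?Ws = "mat_of_cols n ws" and ?Us = "mat_of_cols n us" and ?W = "mat_of_cols n (ws @ us)"
  have Qc: "Q \<in> carrier_mat n n" using Q unfolding is_projection_onto_def by auto
  have wsc: "set ws \<subseteq> carrier_vec n" and usc: "set us \<subseteq> carrier_vec n"
    using ws us unfolding is_basis_of_def by auto
  have Ws: "?Ws \<in> carrier_mat n ?k" and Us: "?Us \<in> carrier_mat n ?l" by auto
  have W_app: "?W *\<^sub>v (a @\<^sub>v b) = ?Ws *\<^sub>v a + ?Us *\<^sub>v b"
    if "a \<in> carrier_vec ?k" "b \<in> carrier_vec ?l" for a b
    using mat_of_cols_append_mult_vec[OF wsc usc that] .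
  have ws_inj: "a = 0\<^sub>v ?k" if "a \<in> carrier_vec ?k" "?Ws *\<^sub>v a = 0\<^sub>v n" for a
    using ws that unfolding is_basis_of_iff[OF wsc] by auto
  have us_inj: "b = 0\<^sub>v ?l" if "b \<in> carrier_vec ?l" "?Us *\<^sub>v b = 0\<^sub>v n" for b
    using us that unfolding is_basis_of_iff[OF usc] by auto
  have ws_img: "mat_image ?Ws = mat_image Q" using ws unfolding is_basis_of_iff[OF wsc] by auto
  have us_img: "mat_image ?Us = mat_kernel Q" using us unfolding is_basis_of_iff[OF usc] by auto
  have appc: "set (ws @ us) \<subseteq> carrier_vec n" using wsc usc by auto
  show ?thesis
    unfolding is_basis_of_iff[OF appc]
  proof (intro conjI ballI impI)
    fix v assume v: "v \<in> carrier_vec (length (ws @ us))" and Wv: "?W *\<^sub>v v = 0\<^sub>v n"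
    define a b where "a = vec_first v ?k" and "b = vec_last v ?l"
    have ab: "a \<in> carrier_vec ?k" "b \<in> carrier_vec ?l" "v = a @\<^sub>v b"
      using v by (auto simp: a_def b_def)
    have Wa: "?Ws *\<^sub>v a \<in> mat_image Q" using ws_img ab(1) by (auto simp: mat_image_def)
    have Ub: "?Us *\<^sub>v b \<in> mat_kernel Q" using us_img ab(2) by (auto simp: mat_image_def)
    have Wac: "?Ws *\<^sub>v a \<in> carrier_vec n" and Ubc: "?Us *\<^sub>v b \<in> carrier_vec n"
      using ab mult_mat_vec_carrier[OF Ws] mult_mat_vec_carrier[OF Us] by auto
    have sum0: "?Ws *\<^sub>v a + ?Us *\<^sub>v b = 0\<^sub>v n" using Wv W_app ab by simp
    have "?Ws *\<^sub>v a = Q *\<^sub>v (?Ws *\<^sub>v a) + Q *\<^sub>v (?Us *\<^sub>v b)"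
      using projection_mult_image[OF Q Wa] mat_kernelD[OF Qc Ub] Wac by simp
    also have "\<dots> = Q *\<^sub>v (?Ws *\<^sub>v a + ?Us *\<^sub>v b)"
      using mult_add_distrib_mat_vec[OF Qc Wac Ubc] by simp
    also have "\<dots> = 0\<^sub>v n" unfolding sum0 using Qc by auto
    finally have a0: "?Ws *\<^sub>v a = 0\<^sub>v n" .
    then have "?Us *\<^sub>v b = 0\<^sub>v n" using sum0 Ubc by simp
    with a0 have "a = 0\<^sub>v ?k" "b = 0\<^sub>v ?l" using ws_inj us_inj ab by auto
    then show "v = 0\<^sub>v (length (ws @ us))" using ab(3) by (auto simp: vec_eq_iff)
  next
    show "mat_image ?W = carrier_vec n"
    proof
      show "mat_image ?W \<subseteq> carrier_vec n"
        unfolding mat_image_def by (auto intro!: carrier_vecI)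
    next
      show "carrier_vec n \<subseteq> mat_image ?W"
      proof
        fix x :: "complex vec" assume x: "x \<in> carrier_vec n"
        have Qx: "Q *\<^sub>v x \<in> carrier_vec n" using Qc x by auto
        have Qxi: "Q *\<^sub>v x \<in> mat_image Q" using Qc x unfolding mat_image_def by auto
        have "x - Q *\<^sub>v x \<in> mat_kernel Q"
          using Qc x Qx projection_mult_image[OF Q Qxi]
          by (intro mat_kernelI[OF Qc]) (auto simp: mult_minus_distrib_mat_vec[OF Qc])
        with us_img obtain b where b: "b \<in> carrier_vec ?l" "?Us *\<^sub>v b = x - Q *\<^sub>v x"
          unfolding mat_image_def by (metis imageE mat_of_cols_carrier(3))
        from Qxi ws_img obtain a where a: "a \<in> carrier_vec ?k" "?Ws *\<^sub>v a = Q *\<^sub>v x"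
          unfolding mat_image_def by (metis imageE mat_of_cols_carrier(3))
        have "?W *\<^sub>v (a @\<^sub>v b) = Q *\<^sub>v x + (x - Q *\<^sub>v x)"
          using W_app a b by simp
        also have "\<dots> = x" using x Qx Qc by (intro eq_vecI) auto
        finally have "x = ?W *\<^sub>v (a @\<^sub>v b)" ..
        moreover have "a @\<^sub>v b \<in> carrier_vec (dim_col ?W)" using a b by simp
        ultimately show "x \<in> mat_image ?W" unfolding mat_image_def by blast
      qed
    qed
  qed
qed

lemma deflated_carrier:
  assumes "K \<in> carrier_mat n n" "Q \<in> carrier_mat n n"
  shows "deflated n K Q \<in> carrier_mat n n"
  using assms unfolding deflated_def by auto

lemma deflated_mult_vec:
  assumes K: "K \<in> carrier_mat n n" and Q: "Q \<in> carrier_mat n n" and v: "v \<in> carrier_vec n"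
  shows "deflated n K Q *\<^sub>v v = Q *\<^sub>v v + K *\<^sub>v (v - Q *\<^sub>v v)"
proof -
  have R: "1\<^sub>m n - Q \<in> carrier_mat n n" using minus_carrier_mat[OF Q] .
  show ?thesis
    unfolding deflated_def add_mult_distrib_mat_vec[OF Q mult_carrier_mat[OF K R] v]
      assoc_mult_mat_vec[OF K R v] minus_mult_distrib_mat_vec[OF one_carrier_mat Q v]
    using v by simp
qed

lemma deflated_mult_image:
  assumes K: "K \<in> carrier_mat n n" and Q: "is_projection_onto n Q S" and v: "v \<in> mat_image Q"
  shows "deflated n K Q *\<^sub>v v = v"
proof -
  have Qc: "Q \<in> carrier_mat n n" using Q unfolding is_projection_onto_def by auto
  have vc: "v \<in> carrier_vec n" using v Qc unfolding mat_image_def by auto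
  show ?thesis
    unfolding deflated_mult_vec[OF K Qc vc] projection_mult_image[OF Q v]
    using vc mult_mat_zero_vec[OF K] by simp
qed

text \<open>
  The block triangular matrix is the deflated operator written in the basis \<open>ws @ us\<close>.  On the
  image of \<open>Q\<close> the operator is the identity, which is the first block column.  On the kernel it
  is \<open>K\<close>, and the second block column splits \<open>K u\<close> into \<open>Q K u\<close> and \<open>(1 - Q) K u\<close>.
\<close>

lemma block_triangular_coordinates:
  assumes K: "K \<in> carrier_mat n n" and Q: "is_projection_onto n Q S"
    and ws: "is_basis_of n ws (mat_image Q)" and us: "is_basis_of n us (mat_kernel Q)"
  defines "T \<equiv> block_triangular n K Q ws us"
  shows "T \<in> carrier_mat n n"
    and "v \<in> carrier_vec n \<Longrightarrow>
      mat_of_cols n (ws @ us) *\<^sub>v (T *\<^sub>v v) = deflated n K Q *\<^sub>v (mat_of_cols n (ws @ us) *\<^sub>v v)"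
proof -
  let ?k = "length ws" and ?l = "length us"
  let ?Ws = "mat_of_cols n ws" and ?Us = "mat_of_cols n us" and ?W = "mat_of_cols n (ws @ us)"
  let ?R = "1\<^sub>m n - Q"
  have Qc: "Q \<in> carrier_mat n n" and QQ: "Q * Q = Q"
    using Q unfolding is_projection_onto_def by auto
  have R: "?R \<in> carrier_mat n n" using minus_carrier_mat[OF Qc] .
  have wsc: "set ws \<subseteq> carrier_vec n" and usc: "set us \<subseteq> carrier_vec n"
    using ws us unfolding is_basis_of_def by auto
  have Ws: "?Ws \<in> carrier_mat n ?k" and Us: "?Us \<in> carrier_mat n ?l" by auto
  have kl: "?k + ?l = n"
    using length_basis_of_carrier_vec[OF is_basis_of_projection_append[OF Q ws us]] by simp
  have QKR: "Q * K * ?R \<in> carrier_mat n n" and RKR: "?R * K * ?R \<in> carrier_mat n n"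
    using Qc K R by auto
  have assoc: "X * K * ?R *\<^sub>v x = X *\<^sub>v (K *\<^sub>v (?R *\<^sub>v x))"
    if X: "X \<in> carrier_mat n n" and x: "x \<in> carrier_vec n" for X x
    unfolding assoc_mult_mat_vec[OF mult_carrier_mat[OF X K] R x]
    by (rule assoc_mult_mat_vec[OF X K]) (use R x in auto)
  define A11 where "A11 = map_matrix n Q ws ws"
  define A12 where "A12 = map_matrix n (Q * K * ?R) us ws"
  define A22 where "A22 = map_matrix n (?R * K * ?R) us us"
  have image: "Q *\<^sub>v x \<in> mat_image Q" if "x \<in> carrier_vec n" for x
    using that Qc unfolding mat_image_def by auto
  have kernel: "?R *\<^sub>v x \<in> mat_kernel Q" if x: "x \<in> carrier_vec n" for x
  proof -
    have "Q * ?R = 0\<^sub>m n n"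
      using mult_minus_distrib_mat[OF Qc one_carrier_mat Qc] Qc QQ by simp
    moreover have "0\<^sub>m n n *\<^sub>v x = 0\<^sub>v n" using x by (intro eq_vecI) auto
    ultimately have "Q *\<^sub>v (?R *\<^sub>v x) = 0\<^sub>v n" using assoc_mult_mat_vec[OF Qc R x] by simp
    then show ?thesis using mat_kernelI[OF Qc] mult_mat_vec_carrier[OF R x] by blast
  qed
  have A11: "A11 \<in> carrier_mat ?k ?k" "Q * ?Ws = ?Ws * A11"
    unfolding A11_def using map_matrix[OF ws Qc wsc] image wsc by auto
  have "Q * K * ?R *\<^sub>v b \<in> mat_image Q" if "b \<in> set us" for b
  proof -
    have b: "b \<in> carrier_vec n" using that usc by auto
    have "Q * K * ?R *\<^sub>v b = Q *\<^sub>v (K *\<^sub>v (?R *\<^sub>v b))" by (rule assoc[OF Qc b])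
    then show ?thesis using image K R b by simp
  qed
  then have A12: "A12 \<in> carrier_mat ?k ?l" "Q * K * ?R * ?Us = ?Ws * A12"
    unfolding A12_def using map_matrix[OF ws QKR usc] by auto
  have "?R * K * ?R *\<^sub>v b \<in> mat_kernel Q" if "b \<in> set us" for b
  proof -
    have b: "b \<in> carrier_vec n" using that usc by auto
    have "?R * K * ?R *\<^sub>v b = ?R *\<^sub>v (K *\<^sub>v (?R *\<^sub>v b))" by (rule assoc[OF R b])
    then show ?thesis using kernel K R b by simp
  qed
  then have A22: "A22 \<in> carrier_mat ?l ?l" "?R * K * ?R * ?Us = ?Us * A22"
    unfolding A22_def using map_matrix[OF us RKR usc] by auto
  have T: "T = four_block_mat A11 A12 (0\<^sub>m ?l ?k) A22"
    unfolding T_def block_triangular_def A11_def A12_def A22_def ..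
  show Tc: "T \<in> carrier_mat n n" unfolding T using A11 A22 kl by (metis four_block_carrier_mat)
  assume v: "v \<in> carrier_vec n"
  define a b where "a = vec_first v ?k" and "b = vec_last v ?l"
  have ab: "a \<in> carrier_vec ?k" "b \<in> carrier_vec ?l" "v = a @\<^sub>v b"
    using v kl by (auto simp: a_def b_def)
  define x where "x = ?Ws *\<^sub>v a"
  define y where "y = ?Us *\<^sub>v b"
  have xc: "x \<in> carrier_vec n" and yc: "y \<in> carrier_vec n"
    unfolding x_def y_def using mult_mat_vec_carrier[OF Ws ab(1)] mult_mat_vec_carrier[OF Us ab(2)] by auto
  have xQ: "x \<in> mat_image Q"
    using ws ab(1) unfolding is_basis_of_iff[OF wsc] mat_image_def x_def by force
  have yQ: "y \<in> mat_kernel Q"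
    using us ab(2) unfolding is_basis_of_iff[OF usc] mat_image_def y_def by force
  have Qy: "Q *\<^sub>v y = 0\<^sub>v n" using mat_kernelD[OF Qc yQ] by simp
  have Ry: "?R *\<^sub>v y = y"
    using minus_mult_distrib_mat_vec[OF one_carrier_mat Qc yc] Qy yc by simp
  define t where "t = K *\<^sub>v y"
  have tc: "t \<in> carrier_vec n" unfolding t_def using K yc by auto
  have Wv: "?W *\<^sub>v v = x + y"
    unfolding ab(3) x_def y_def using mat_of_cols_append_mult_vec[OF wsc usc ab(1,2)] .
  have c: "A11 *\<^sub>v a \<in> carrier_vec ?k" "A12 *\<^sub>v b \<in> carrier_vec ?k" "A22 *\<^sub>v b \<in> carrier_vec ?l"
    using A11 A12 A22 ab by auto
  have "T *\<^sub>v v = (A11 *\<^sub>v a + A12 *\<^sub>v b) @\<^sub>v (0\<^sub>m ?l ?k *\<^sub>v a + A22 *\<^sub>v b)"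
    unfolding T ab(3) by (rule four_block_mat_mult_vec[OF A11(1) A12(1) zero_carrier_mat A22(1) ab(1,2)])
  also have "0\<^sub>m ?l ?k *\<^sub>v a + A22 *\<^sub>v b = A22 *\<^sub>v b"
    using ab(1) c(3) A22(1) by (intro eq_vecI) auto
  finally have "?W *\<^sub>v (T *\<^sub>v v) = ?Ws *\<^sub>v (A11 *\<^sub>v a + A12 *\<^sub>v b) + ?Us *\<^sub>v (A22 *\<^sub>v b)"
    using mat_of_cols_append_mult_vec[OF wsc usc] c by simp
  also have "\<dots> = ?Ws *\<^sub>v (A11 *\<^sub>v a) + ?Ws *\<^sub>v (A12 *\<^sub>v b) + ?Us *\<^sub>v (A22 *\<^sub>v b)"
    using mult_add_distrib_mat_vec[OF Ws c(1,2)] by simp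
  also have "?Ws *\<^sub>v (A11 *\<^sub>v a) = Q *\<^sub>v x"
    unfolding x_def assoc_mult_mat_vec[OF Ws A11(1) ab(1), symmetric] A11(2)[symmetric]
    by (rule assoc_mult_mat_vec[OF Qc Ws ab(1)])
  also have "\<dots> = x" by (rule projection_mult_image[OF Q xQ])
  also have "?Ws *\<^sub>v (A12 *\<^sub>v b) = Q * K * ?R *\<^sub>v y"
    unfolding y_def assoc_mult_mat_vec[OF Ws A12(1) ab(2), symmetric] A12(2)[symmetric]
    by (rule assoc_mult_mat_vec[OF QKR Us ab(2)])
  also have "\<dots> = Q *\<^sub>v t" unfolding t_def assoc[OF Qc yc] Ry ..
  also have "?Us *\<^sub>v (A22 *\<^sub>v b) = ?R * K * ?R *\<^sub>v y"
    unfolding y_def assoc_mult_mat_vec[OF Us A22(1) ab(2), symmetric] A22(2)[symmetric]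
    by (rule assoc_mult_mat_vec[OF RKR Us ab(2)])
  also have "\<dots> = ?R *\<^sub>v t" unfolding t_def assoc[OF R yc] Ry ..
  also have "\<dots> = t - Q *\<^sub>v t"
    using minus_mult_distrib_mat_vec[OF one_carrier_mat Qc tc] tc by simp
  also have "x + Q *\<^sub>v t + (t - Q *\<^sub>v t) = x + t"
    using xc tc Qc by (intro eq_vecI) auto
  also have "x = deflated n K Q *\<^sub>v x" by (rule deflated_mult_image[OF K Q xQ, symmetric])
  also have "t = deflated n K Q *\<^sub>v y"
    using tc yc unfolding deflated_mult_vec[OF K Qc yc] Qy t_def by simp
  also have "deflated n K Q *\<^sub>v x + deflated n K Q *\<^sub>v y = deflated n K Q *\<^sub>v (?W *\<^sub>v v)"
    unfolding Wv by (rule mult_add_distrib_mat_vec[OF deflated_carrier[OF K Qc] xc yc, symmetric])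
  finally show "?W *\<^sub>v (T *\<^sub>v v) = deflated n K Q *\<^sub>v (?W *\<^sub>v v)" .
qed

text \<open>
  The deflated operator fixes the image of \<open>Q\<close> pointwise, so an eigenvector that represents a
  vector of the image can only belong to the eigenvalue 1.
\<close>

lemma block_triangular_eigenvalue_in_image:
  assumes K: "K \<in> carrier_mat n n" and Q: "is_projection_onto n Q S"
    and ws: "is_basis_of n ws (mat_image Q)" and us: "is_basis_of n us (mat_kernel Q)"
    and ev: "eigenvector (block_triangular n K Q ws us) v \<mu>"
    and vS: "mat_of_cols n (ws @ us) *\<^sub>v v \<in> S"
  shows "\<mu> = 1"
proof -
  let ?T = "block_triangular n K Q ws us" and ?W = "mat_of_cols n (ws @ us)"
  note T = block_triangular_coordinates[OF K Q ws us]
  have b: "is_basis_of n (ws @ us) (carrier_vec n)"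
    by (rule is_basis_of_projection_append[OF Q ws us])
  have len: "length (ws @ us) = n" by (rule length_basis_of_carrier_vec[OF b])
  have bc: "set (ws @ us) \<subseteq> carrier_vec n" using b unfolding is_basis_of_def by auto
  have v: "v \<in> carrier_vec n" "v \<noteq> 0\<^sub>v n" "?T *\<^sub>v v = \<mu> \<cdot>\<^sub>v v"
    using ev T(1) unfolding eigenvector_def by auto
  have W: "?W \<in> carrier_mat n n" using len mat_of_cols_carrier(1)[of n "ws @ us"] by metis
  have Wv0: "?W *\<^sub>v v \<noteq> 0\<^sub>v n"
    using b v len unfolding is_basis_of_iff[OF bc] by auto
  then obtain i where i: "i < n" "(?W *\<^sub>v v) $ i \<noteq> 0" using W by (auto simp: vec_eq_iff)
  have "?W *\<^sub>v v \<in> mat_image Q" using vS Q unfolding is_projection_onto_def by auto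
  then have "?W *\<^sub>v v = ?W *\<^sub>v (?T *\<^sub>v v)"
    using T(2)[OF v(1)] deflated_mult_image[OF K Q] by simp
  also have "\<dots> = \<mu> \<cdot>\<^sub>v (?W *\<^sub>v v)" unfolding v(3) by (rule mult_mat_vec[OF W v(1)])
  finally have "(?W *\<^sub>v v) $ i = (\<mu> \<cdot>\<^sub>v (?W *\<^sub>v v)) $ i" by (rule arg_cong)
  moreover have "(\<mu> \<cdot>\<^sub>v (?W *\<^sub>v v)) $ i = \<mu> * (?W *\<^sub>v v) $ i"
    using i(1) W by (intro index_smult_vec) simp
  ultimately show ?thesis using i(2) by (metis mult_cancel_right1)
qed

theorem proposition4:
  fixes n :: nat
    and A P :: "real mat"
    and zs \<delta>s ws us :: "complex vec list"
    and Z Zu :: "complex vec set"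
    and QR Qu NT N \<delta>N V :: "complex mat"
    and lam :: real
    and p :: ereal
  assumes n: "0 < n"
    and A: "A \<in> carrier_mat n n" "invertible_mat A"
    and P: "P \<in> carrier_mat n n" "invertible_mat P"
    and Z_basis: "is_basis_of n zs Z"
    and Z_eigen: "\<And>i. i < length zs \<Longrightarrow> \<exists>\<mu>. eigenvector (preconditioned P A) (zs ! i) \<mu>"
    and Z_invariant: "\<And>v. v \<in> Z \<Longrightarrow> preconditioned P A *\<^sub>v v \<in> Z"
    and perturbation: "length \<delta>s = length zs" "set \<delta>s \<subseteq> carrier_vec n"
    and Zu: "Zu = cspan n (set (map2 (+) zs \<delta>s))"
    and QR: "is_projection_onto n QR Z"
    and Qu: "is_projection_onto n Qu Zu"
    and ws: "is_basis_of n ws (mat_image QR)"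
    and us: "is_basis_of n us (mat_kernel QR)"
    and NT: "NT = block_triangular n (preconditioned P A) QR ws us"
    and N: "N = map_matrix n (deflated n (preconditioned P A) Qu) (ws @ us) (ws @ us)"
    and \<delta>N: "\<delta>N = N - NT"
    and lam: "lam = spectral_radius NT"
    and V: "V \<in> carrier_mat n n" "invertible_mat V"
           "\<And>j. j < n \<Longrightarrow> \<exists>\<mu>. eigenvector NT (col V j) \<mu>"
    and p: "1 \<le> p"
  shows "spectral_radius N \<le> lam + cond_number p V * mat_pnorm p \<delta>N
    \<and> (\<forall>\<nu> \<in> eigenvalue_moduli_outside n NT (ws @ us) Z.
         1 \<le> \<nu> \<and> (\<forall>\<nu>' \<in> eigenvalue_moduli_outside n NT (ws @ us) Z. \<nu>' \<le> \<nu>) \<longrightarrow> lam = \<nu>)"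
proof -
  let ?K = "preconditioned P A"
  have "mat_inv P \<in> carrier_mat n n" using mat_inv(1)[OF P] .
  then have K: "?K \<in> carrier_mat n n" using A(1) unfolding preconditioned_def by auto
  have Qu_carrier: "Qu \<in> carrier_mat n n" using Qu unfolding is_projection_onto_def by auto
  have NT_carrier: "NT \<in> carrier_mat n n"
    unfolding NT by (rule block_triangular_coordinates(1)[OF K QR ws us])
  have basis: "is_basis_of n (ws @ us) (carrier_vec n)"
    by (rule is_basis_of_projection_append[OF QR ws us])
  have len: "length (ws @ us) = n" by (rule length_basis_of_carrier_vec[OF basis])
  have N_carrier: "N \<in> carrier_mat n n"
  proof -
    have "set (ws @ us) \<subseteq> carrier_vec n" using basis unfolding is_basis_of_def by blast
    moreover note D = deflated_carrier[OF K Qu_carrier]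
    ultimately have "N \<in> carrier_mat (length (ws @ us)) (length (ws @ us))"
      unfolding N by (intro map_matrix(1)[OF basis D]) (use D in \<open>auto intro!: mult_mat_vec_carrier[OF D]\<close>)
    then show ?thesis unfolding len .
  qed
  have split: "N = NT + \<delta>N"
    unfolding \<delta>N using N_carrier NT_carrier by (intro eq_matI) auto
  have \<delta>N_carrier: "\<delta>N \<in> carrier_mat n n"
    unfolding \<delta>N using minus_carrier_mat[OF NT_carrier] .
  have bound: "spectral_radius N \<le> lam + cond_number p V * mat_pnorm p \<delta>N"
    unfolding split lam by (rule spectral_radius_perturbation[OF n p NT_carrier \<delta>N_carrier V])
  have largest: "lam = \<nu>"
    if \<nu>: "\<nu> \<in> eigenvalue_moduli_outside n NT (ws @ us) Z" "1 \<le> \<nu>"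
      and \<nu>_max: "\<forall>\<nu>' \<in> eigenvalue_moduli_outside n NT (ws @ us) Z. \<nu>' \<le> \<nu>" for \<nu>
  proof (rule antisym)
    obtain \<mu> v where \<mu>: "eigenvector NT v \<mu>" "lam = cmod \<mu>"
      using spectral_radius_mem_max(1)[OF NT_carrier n]
      unfolding lam spectrum_def eigenvalue_def by auto
    show "lam \<le> \<nu>"
    proof (cases "mat_of_cols n (ws @ us) *\<^sub>v v \<in> Z")
      case True
      have "\<mu> = 1"
        by (rule block_triangular_eigenvalue_in_image[OF K QR ws us \<mu>(1)[unfolded NT] True])
      then show ?thesis using \<mu>(2) \<nu>(2) by simp
    next
      case False
      then show ?thesis using \<mu> \<nu>_max unfolding eigenvalue_moduli_outside_def by blast
    qed
    show "\<nu> \<le> lam"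
      using \<nu>(1) spectral_radius_mem_max(2)[OF NT_carrier n, of \<nu>]
      unfolding lam eigenvalue_moduli_outside_def spectrum_def eigenvalue_def by auto
  qed
  show ?thesis using bound largest by blast
qed

end
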